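(* Let $\sigma:\Sigma\to\Sigma$ be a subshift of finite type, let $\varphi\in C^0(\Sigma,\mathbb Q^n)$ be a locally constant function and let $A\in C^0(\Sigma)$ be a Walters function. Let $r\in\varphi_*(\mathcal M_\sigma)\cap\mathbb Q^n$ and assume the existence of an ergodic $(A,r)$-maximizing probability in relation to which $\varphi$ is joint recurrent. Then $$\beta_{A,\varphi}(r)=\sup\left\{\int A\,d\mu:\ \mu\in\varphi_*^{-1}(r),\ \mu\text{ a periodic probability measure}\right\}.$$
   Context: $\Sigma$ is a one-sided subshift of finite type over a finite alphabet, with points $\mathbf x=(x_0,x_1,\dots)$ and shift map $\sigma$; it carries the metric $d(\mathbf x,\mathbf y)=\lambda^k$, $k=\min\{j:x_j\ne y_j\}$ (and $d(\mathbf x,\mathbf x)=0$), for a fixed $\lambda\in(0,1)$. $\mathcal M_\sigma$ is the set of $\sigma$-invariant Borel probability measures. For $\varphi=(\varphi_1,\dots,\varphi_n)\in C^0(\Sigma,\mathbb R^n)$ and $\mu\in\mathcal M_\sigma$, $\varphi_*(\mu)=\left(\int\varphi_1\,d\mu,\dots,\int\varphi_n\,d\mu\right)$, and $\varphi_*^{-1}(r)=\{\mu\in\mathcal M_\sigma:\varphi_*(\mu)=r\}$. $C^0(\Sigma,\mathbb Q^n)$ denotes the continuous functions $\Sigma\to\mathbb R^n$ with values in $\mathbb Q^n$. For $r\in\varphi_*(\mathcal M_\sigma)$, $\beta_{A,\varphi}(r)=\sup\{\int A\,d\mu:\mu\in\varphi_*^{-1}(r)\}$; an $(A,r)$-maximizing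 probability is a $\mu\in\varphi_*^{-1}(r)$ with $\int A\,d\mu=\beta_{A,\varphi}(r)$. A continuous function $g$ on $\Sigma$ is locally constant if there is an integer $j\ge0$ such that $g(\mathbf x)=g(\mathbf y)$ whenever $x_0=y_0,\dots,x_j=y_j$. Put $S_kf=\sum_{j=0}^{k-1}f\circ\sigma^j$ and $d_k(\mathbf x,\mathbf y)=\max_{0\le j<k}d(\sigma^j\mathbf x,\sigma^j\mathbf y)$. A function $f\in C^0(\Sigma)$ is a Walters function (Walters potential) if there is an increasing function $H:\mathbb R^+\to\mathbb R^+\cup\{+\infty\}$, null and continuous at zero, such that for all $s\in\mathbb R^+$, $k>0$, $\mathbf x,\mathbf y\in\Sigma$: $d_k(\mathbf x,\mathbf y)\le s$ implies $|S_kf(\mathbf x)-S_kf(\mathbf y)|\le H(s)$. For $\nu\in\mathcal M_\sigma$ and a Borel set $D$ let $\Xi(D)$ be the set of $z\in D$ such that for every $\epsilon>0$ there is a positive integer $L$ with $\sigma^L(z)\in D$ and $\|S_L\varphi(z)-L\varphi_*(\nu)\|<\epsilon$. The function $\varphi$ is joint recurrent in relation to $\nu$ if $\nu(\Xi(D))=\nu(D)$ for every Borel set $D$. A periodic probability measure is a measure of the form $\frac1M\sum_{j=0}^{M-1}\delta_{\sigma^j(\mathbf x)}$ with $\mathbf x$ a periodic point of period $M$. *)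

theory Defs
  imports "HOL-Analysis.Analysis" "HOL-Probability.Probability"
begin

definition shift :: "(nat \<Rightarrow> 'a) \<Rightarrow> nat \<Rightarrow> 'a" where
  "shift x = (\<lambda>i. x (Suc i))"

text \<open>A word \<open>w\<close> occurs in \<open>x\<close> at position \<open>i\<close> iff \<open>map x [i..<i + length w] = w\<close>.
  Transition-matrix subshifts are the case where all forbidden words have length 2.\<close>

definition subshift_of_finite_type :: "(nat \<Rightarrow> 'a::finite) set \<Rightarrow> bool" where
  "subshift_of_finite_type \<Sigma> \<longleftrightarrow>
     (\<exists>F :: 'a list set. finite F \<and>
        \<Sigma> = {x. \<forall>w\<in>F. \<forall>i. map x [i..<i + length w] \<noteq> w})"

definition seq_dist :: "real \<Rightarrow> (nat \<Rightarrow> 'a) \<Rightarrow> (nat \<Rightarrow> 'a) \<Rightarrow> real" where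
  "seq_dist l x y = (if x = y then 0 else l ^ (LEAST j. x j \<noteq> y j))"

lemma Metric_space_seq_dist:
  assumes "0 < l" "l < 1"
  shows "Metric_space \<Sigma> (seq_dist l)"
proof
  fix x y z :: "nat \<Rightarrow> 'a"
  show "0 \<le> seq_dist l x y"
    using assms by (simp add: seq_dist_def)
  show "seq_dist l x y = seq_dist l y x"
    by (simp add: seq_dist_def eq_commute)
  show "(seq_dist l x y = 0) = (x = y)"
    using assms by (simp add: seq_dist_def)
  show "seq_dist l x z \<le> seq_dist l x y + seq_dist l y z"
  proof (cases "x = y \<or> y = z \<or> x = z")
    case True
    then show ?thesis using assms by (auto simp: seq_dist_def)
  next
    case False
    define k where "k = (LEAST j. x j \<noteq> z j)"
    from False have "\<exists>j. x j \<noteq> z j" by auto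
    then have "x k \<noteq> z k" unfolding k_def by (rule LeastI_ex)
    then have "x k \<noteq> y k \<or> y k \<noteq> z k" by auto
    then have "(LEAST j. x j \<noteq> y j) \<le> k \<or> (LEAST j. y j \<noteq> z j) \<le> k"
      by (auto intro: Least_le)
    then have "l ^ k \<le> l ^ (LEAST j. x j \<noteq> y j) \<or> l ^ k \<le> l ^ (LEAST j. y j \<noteq> z j)"
      using assms by (auto intro: power_decreasing)
    moreover have "0 \<le> l ^ (LEAST j. x j \<noteq> y j)" "0 \<le> l ^ (LEAST j. y j \<noteq> z j)"
      using assms by auto
    ultimately show ?thesis
      using False by (auto simp: seq_dist_def k_def)
  qed
qed

definition shift_topology :: "real \<Rightarrow> (nat \<Rightarrow> 'a) set \<Rightarrow> (nat \<Rightarrow> 'a) topology" where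
  "shift_topology l \<Sigma> = Metric_space.mtopology \<Sigma> (seq_dist l)"

text \<open>Only the \<open>sets\<close> and \<open>space\<close> of this measure matter.\<close>

definition shift_borel :: "real \<Rightarrow> (nat \<Rightarrow> 'a) set \<Rightarrow> (nat \<Rightarrow> 'a) measure" where
  "shift_borel l \<Sigma> = sigma \<Sigma> {U. openin (shift_topology l \<Sigma>) U}"

definition invariant_measures :: "real \<Rightarrow> (nat \<Rightarrow> 'a) set \<Rightarrow> (nat \<Rightarrow> 'a) measure set" where
  "invariant_measures l \<Sigma> =
     {\<mu>. sets \<mu> = sets (shift_borel l \<Sigma>) \<and> prob_space \<mu> \<and>
         (\<forall>B\<in>sets \<mu>. measure \<mu> (shift -` B \<inter> space \<mu>) = measure \<mu> B)}"

definition ergodic :: "(nat \<Rightarrow> 'a) measure \<Rightarrow> bool" where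
  "ergodic \<mu> \<longleftrightarrow>
     (\<forall>B\<in>sets \<mu>. shift -` B \<inter> space \<mu> = B \<longrightarrow> measure \<mu> B = 0 \<or> measure \<mu> B = 1)"

definition rotation :: "((nat \<Rightarrow> 'a) \<Rightarrow> real ^ 'n) \<Rightarrow> (nat \<Rightarrow> 'a) measure \<Rightarrow> real ^ 'n" where
  "rotation \<phi> \<mu> = (\<chi> i. \<integral>x. \<phi> x $ i \<partial>\<mu>)"

definition rotation_fiber ::
    "real \<Rightarrow> (nat \<Rightarrow> 'a) set \<Rightarrow> ((nat \<Rightarrow> 'a) \<Rightarrow> real ^ 'n) \<Rightarrow> real ^ 'n \<Rightarrow> (nat \<Rightarrow> 'a) measure set" where
  "rotation_fiber l \<Sigma> \<phi> r = {\<mu> \<in> invariant_measures l \<Sigma>. rotation \<phi> \<mu> = r}"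

text \<open>Suprema are taken in \<^typ>\<open>ereal\<close>, so that the supremum of an empty set is \<open>-\<infinity>\<close>
  and not an unspecified real number.\<close>

definition beta ::
    "real \<Rightarrow> (nat \<Rightarrow> 'a) set \<Rightarrow> ((nat \<Rightarrow> 'a) \<Rightarrow> real) \<Rightarrow> ((nat \<Rightarrow> 'a) \<Rightarrow> real ^ 'n) \<Rightarrow> real ^ 'n \<Rightarrow> ereal" where
  "beta l \<Sigma> A \<phi> r = (SUP \<mu>\<in>rotation_fiber l \<Sigma> \<phi> r. ereal (\<integral>x. A x \<partial>\<mu>))"

definition maximizing ::
    "real \<Rightarrow> (nat \<Rightarrow> 'a) set \<Rightarrow> ((nat \<Rightarrow> 'a) \<Rightarrow> real) \<Rightarrow> ((nat \<Rightarrow> 'a) \<Rightarrow> real ^ 'n) \<Rightarrow> real ^ 'n \<Rightarrow>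
     (nat \<Rightarrow> 'a) measure \<Rightarrow> bool" where
  "maximizing l \<Sigma> A \<phi> r \<mu> \<longleftrightarrow>
     \<mu> \<in> rotation_fiber l \<Sigma> \<phi> r \<and> ereal (\<integral>x. A x \<partial>\<mu>) = beta l \<Sigma> A \<phi> r"

definition locally_constant :: "(nat \<Rightarrow> 'a) set \<Rightarrow> ((nat \<Rightarrow> 'a) \<Rightarrow> 'b) \<Rightarrow> bool" where
  "locally_constant \<Sigma> g \<longleftrightarrow> (\<exists>j. \<forall>x\<in>\<Sigma>. \<forall>y\<in>\<Sigma>. (\<forall>i\<le>j. x i = y i) \<longrightarrow> g x = g y)"

definition birkhoff_sum :: "nat \<Rightarrow> ((nat \<Rightarrow> 'a) \<Rightarrow> 'b::comm_monoid_add) \<Rightarrow> (nat \<Rightarrow> 'a) \<Rightarrow> 'b" where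
  "birkhoff_sum k f x = (\<Sum>j<k. f ((shift ^^ j) x))"

text \<open>Only meaningful for \<open>k > 0\<close>.\<close>

definition bowen_dist :: "real \<Rightarrow> nat \<Rightarrow> (nat \<Rightarrow> 'a) \<Rightarrow> (nat \<Rightarrow> 'a) \<Rightarrow> real" where
  "bowen_dist l k x y = (MAX j\<in>{..<k}. seq_dist l ((shift ^^ j) x) ((shift ^^ j) y))"

text \<open>The modulus \<open>H\<close> is defined on \<open>{0..}\<close>; its values outside are irrelevant. Since it
  may take the value \<open>\<infinity>\<close>, increasing means nondecreasing.\<close>

definition walters :: "real \<Rightarrow> (nat \<Rightarrow> 'a) set \<Rightarrow> ((nat \<Rightarrow> 'a) \<Rightarrow> real) \<Rightarrow> bool" where
  "walters l \<Sigma> f \<longleftrightarrow>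
     continuous_map (shift_topology l \<Sigma>) euclideanreal f \<and>
     (\<exists>H :: real \<Rightarrow> ennreal.
        mono_on {0..} H \<and> H 0 = 0 \<and> continuous (at 0 within {0..}) H \<and>
        (\<forall>s\<ge>0. \<forall>k>0. \<forall>x\<in>\<Sigma>. \<forall>y\<in>\<Sigma>. bowen_dist l k x y \<le> s \<longrightarrow>
           ennreal \<bar>birkhoff_sum k f x - birkhoff_sum k f y\<bar> \<le> H s))"

definition return_set ::
    "((nat \<Rightarrow> 'a) \<Rightarrow> real ^ 'n) \<Rightarrow> (nat \<Rightarrow> 'a) measure \<Rightarrow> (nat \<Rightarrow> 'a) set \<Rightarrow> (nat \<Rightarrow> 'a) set" where
  "return_set \<phi> \<nu> D =
     {z \<in> D. \<forall>\<epsilon>>0. \<exists>L>0. (shift ^^ L) z \<in> D \<and>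
        norm (birkhoff_sum L \<phi> z - real L *\<^sub>R rotation \<phi> \<nu>) < \<epsilon>}"

definition joint_recurrent :: "((nat \<Rightarrow> 'a) \<Rightarrow> real ^ 'n) \<Rightarrow> (nat \<Rightarrow> 'a) measure \<Rightarrow> bool" where
  "joint_recurrent \<phi> \<nu> \<longleftrightarrow> (\<forall>D\<in>sets \<nu>. measure \<nu> (return_set \<phi> \<nu> D) = measure \<nu> D)"

text \<open>\<^const>\<open>return\<close> is the Dirac measure. The period \<open>M\<close> need not be minimal; this
  does not affect the measure obtained.\<close>

definition periodic_measure :: "real \<Rightarrow> (nat \<Rightarrow> 'a) set \<Rightarrow> (nat \<Rightarrow> 'a) measure \<Rightarrow> bool" where
  "periodic_measure l \<Sigma> \<mu> \<longleftrightarrow>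
     sets \<mu> = sets (shift_borel l \<Sigma>) \<and>
     (\<exists>x\<in>\<Sigma>. \<exists>M>0. (shift ^^ M) x = x \<and>
        (\<forall>B\<in>sets \<mu>. emeasure \<mu> B =
           (\<Sum>j<M. emeasure (return (shift_borel l \<Sigma>) ((shift ^^ j) x)) B) / of_nat M))"

end

theory Submission
  imports Defs
begin

text \<open>
  Periodic measures in the fibre of \<open>r\<close> are among the competitors in the supremum defining \<open>\<beta>(r)\<close>,
  so only one inequality needs an argument: given a maximizing, jointly recurrent \<open>\<nu>\<close> and
  \<open>e > 0\<close>, there is a periodic measure in the fibre whose \<open>A\<close>-integral is at least
  \<open>\<beta>(r) - e\<close> (lemma \<open>periodic_approximation\<close>).

  The measure is obtained by closing up a recurrent orbit segment. Suppose that \<open>z\<close> returns after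
  \<open>L\<close> steps to the cylinder of its own first \<open>p\<close> symbols. Repeating \<open>z\<^sub>0 \<dots> z\<^bsub>L-1\<^esub>\<close>
  gives a point \<open>y\<close> of period \<open>L\<close> that agrees with \<open>z\<close> on the first \<open>L + p\<close> coordinates. If
  \<open>p\<close> is large, then \<open>y\<close> lies in \<open>\<Sigma>\<close>, as only finitely many words are forbidden
  (\<open>sft_closing\<close>); the Birkhoff sums of the locally constant function \<open>\<phi>\<close> over \<open>L\<close> steps coincide
  at \<open>y\<close> and \<open>z\<close>; and those of \<open>A\<close> differ by at most \<open>e/2\<close>, uniformly in \<open>L\<close>, by the
  Walters condition (\<open>walters_uniform\<close>).

  The orbit measure of \<open>y\<close> must have rotation vector exactly \<open>r\<close>. Joint recurrence only
  makes \<open>S\<^sub>L \<phi>(z) - L r\<close> small, but \<open>\<phi>\<close> has finitely many values, all rational, so these differences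
  lie in a fixed lattice and a small one vanishes (\<open>rational_cocycle_discrete\<close>).

  It remains to find \<open>z\<close> with \<open>S\<^sub>L A(z) \<ge> L (\<beta>(r) - e/2)\<close>, although the return time \<open>L\<close> cannot
  be prescribed. The inequality can be had for all \<open>L \<ge> 1\<close> at once: if almost every point violated
  it for some \<open>L\<close>, then the maximal ergodic inequality would make the integral of
  \<open>\<beta>(r) - e/2 - A\<close>, which is \<open>- e/2\<close>, nonnegative. So a set of positive measure satisfies it, and
  almost every point of this set is jointly recurrent in its own \<open>p\<close>-cylinder, since there are
  finitely many such cylinders.
\<close>

section \<open>Maximal ergodic inequality\<close>

text \<open>
  This is the maximum of the ergodic sums of \<open>g\<close> over at most \<open>N\<close> steps, the empty sum included.
  The recursion separates off the first step of the orbit, which is the form in which invariance of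
  the measure enters.
\<close>

primrec max_birkhoff :: "('b \<Rightarrow> 'b) \<Rightarrow> ('b \<Rightarrow> real) \<Rightarrow> nat \<Rightarrow> 'b \<Rightarrow> real" where
  "max_birkhoff T g 0 x = 0"
| "max_birkhoff T g (Suc N) x = max 0 (g x + max_birkhoff T g N (T x))"

lemma max_birkhoff_nonneg: "0 \<le> max_birkhoff T g N x"
  by (cases N) auto

lemma max_birkhoff_le_Suc: "max_birkhoff T g N x \<le> max_birkhoff T g (Suc N) x"
proof (induction N arbitrary: x)
  case (Suc N)
  from Suc[of "T x"] show ?case by (auto simp: max_def)
qed simp

lemma max_birkhoff_mono: "N \<le> N' \<Longrightarrow> max_birkhoff T g N x \<le> max_birkhoff T g N' x"
  by (rule lift_Suc_mono_le[of "\<lambda>N. max_birkhoff T g N x"]) (use max_birkhoff_le_Suc in auto)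

lemma ergodic_sum_le_max_birkhoff: "(\<Sum>j<N. g ((T ^^ j) x)) \<le> max_birkhoff T g N x"
proof (induction N arbitrary: x)
  case (Suc N)
  have "(\<Sum>j<Suc N. g ((T ^^ j) x)) = g x + (\<Sum>j<N. g ((T ^^ j) (T x)))"
    by (simp add: sum.lessThan_Suc_shift funpow_swap1 del: sum.lessThan_Suc)
  with Suc[of "T x"] show ?case by simp
qed simp

text \<open>
  With \<open>m\<^sub>N\<close> the maximal function, \<open>m\<^bsub>N+1\<^esub> - m\<^sub>N \<circ> T\<close> equals \<open>g\<close> where \<open>m\<^bsub>N+1\<^esub> > 0\<close>
  and is at most \<open>0\<close> elsewhere. Its integral is \<open>\<integral>m\<^bsub>N+1\<^esub> - \<integral>m\<^sub>N \<ge> 0\<close>, by invariance and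
  monotonicity in \<open>N\<close>, so \<open>g\<close> has nonnegative integral over \<open>{m\<^bsub>N+1\<^esub> > 0}\<close>. Under the
  positivity hypothesis these sets exhaust almost all of the space.
\<close>

lemma maximal_ergodic_inequality:
  fixes g :: "'b \<Rightarrow> real"
  assumes T: "T \<in> measurable M M" "distr M M T = M"
    and g: "integrable M g"
    and pos: "AE x in M. \<exists>L>0. 0 < (\<Sum>j<L. g ((T ^^ j) x))"
  shows "0 \<le> integral\<^sup>L M g"
proof -
  let ?m = "max_birkhoff T g"
  have T_int: "integrable M (\<lambda>x. f (T x)) \<and> (\<integral>x. f (T x) \<partial>M) = integral\<^sup>L M f"
    if f: "integrable M f" for f :: "'b \<Rightarrow> real"
    using integrable_distr[OF T(1), of f] integral_distr[OF T(1), of f] f T(2) by auto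
  have m_int: "integrable M (?m N)" for N
  proof (induction N)
    case (Suc N)
    then show ?case using T_int[of "?m N"] g by simp
  qed simp
  define E where "E N = {x \<in> space M. 0 < ?m (Suc N) x}" for N
  have E_sets: "E N \<in> sets M" for N
    unfolding E_def using m_int[of "Suc N", THEN borel_measurable_integrable] by measurable
  have E_int: "0 \<le> (\<integral>x. indicator (E N) x * g x \<partial>M)" for N
  proof -
    have "0 \<le> (\<integral>x. ?m (Suc N) x \<partial>M) - (\<integral>x. ?m N x \<partial>M)"
      using integral_mono[OF m_int m_int max_birkhoff_le_Suc] by simp
    also have "\<dots> = (\<integral>x. ?m (Suc N) x - ?m N (T x) \<partial>M)"
      using T_int[OF m_int[of N]] m_int[of "Suc N"] by (simp del: max_birkhoff.simps)
    also have "\<dots> \<le> (\<integral>x. indicator (E N) x * g x \<partial>M)"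
    proof (rule integral_mono)
      show "integrable M (\<lambda>x. ?m (Suc N) x - ?m N (T x))"
        using T_int[OF m_int[of N]] m_int[of "Suc N"] by (simp del: max_birkhoff.simps)
      show "integrable M (\<lambda>x. indicator (E N) x * g x)"
        using integrable_mult_indicator[OF E_sets g] by simp
      show "?m (Suc N) x - ?m N (T x) \<le> indicator (E N) x * g x" if "x \<in> space M" for x
        using that max_birkhoff_nonneg[of T g N "T x"]
        by (auto simp: E_def indicator_def max_def split: if_splits)
    qed
    finally show ?thesis .
  qed
  have "(\<lambda>N. \<integral>x. indicator (E N) x * g x \<partial>M) \<longlonglongrightarrow> integral\<^sup>L M g"
  proof (rule integral_dominated_convergence[where w = "\<lambda>x. \<bar>g x\<bar>"])
    show "AE x in M. (\<lambda>N. indicator (E N) x * g x) \<longlonglongrightarrow> g x"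
      using pos AE_space
    proof eventually_elim
      case (elim x)
      then obtain L where "0 < ?m L x"
        using ergodic_sum_le_max_birkhoff[of g T x] by (meson less_le_trans)
      have "x \<in> E N" if "L \<le> N" for N
        using \<open>0 < ?m L x\<close> elim max_birkhoff_mono[of L "Suc N" T g x] that by (simp add: E_def)
      then have "\<forall>\<^sub>F N in sequentially. indicator (E N) x * g x = g x"
        by (auto simp: eventually_sequentially intro!: exI[of _ L])
      then show ?case by (rule tendsto_eventually)
    qed
    show "AE x in M. norm (indicator (E N) x * g x) \<le> \<bar>g x\<bar>" for N
      by (auto simp: indicator_def)
    show "(\<lambda>x. indicator (E N) x * g x) \<in> borel_measurable M" for N
      using integrable_mult_indicator[OF E_sets[of N] g] by (auto dest: borel_measurable_integrable)
  qed (use g in auto)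
  then show ?thesis
    by (rule LIMSEQ_le_const) (use E_int in auto)
qed

section \<open>The shift space\<close>

lemma shift_funpow: "(shift ^^ j) x = (\<lambda>i. x (i + j))"
  by (induction j arbitrary: x) (auto simp: shift_def fun_eq_iff)

lemma seq_dist_le_iff_agree:
  assumes "0 < l" "l < 1"
  shows "seq_dist l x y \<le> l ^ p \<longleftrightarrow> (\<forall>i<p. x i = y i)"
proof (cases "x = y")
  case False
  let ?k = "LEAST j. x j \<noteq> y j"
  have ex: "\<exists>j. x j \<noteq> y j" using False by auto
  have "p \<le> ?k \<longleftrightarrow> (\<forall>i<p. x i = y i)"
    using LeastI_ex[OF ex] not_less_Least[of _ "\<lambda>j. x j \<noteq> y j"] by (meson le_less_trans not_le)
  with False assms show ?thesis by (simp add: seq_dist_def power_decreasing_iff)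
qed (use assms in \<open>simp add: seq_dist_def\<close>)

text \<open>
  The balls of \<^const>\<open>seq_dist\<close> are cylinders, so the topology does not depend on \<open>l\<close>. All later
  topological arguments use this description in place of the metric.
\<close>

lemma openin_shift_topology:
  assumes l: "0 < l" "l < 1"
  shows "openin (shift_topology l \<Sigma>) U \<longleftrightarrow>
    U \<subseteq> \<Sigma> \<and> (\<forall>x\<in>U. \<exists>p. \<forall>y\<in>\<Sigma>. (\<forall>i<p. x i = y i) \<longrightarrow> y \<in> U)"
proof -
  interpret Metric_space \<Sigma> "seq_dist l" by (rule Metric_space_seq_dist[OF l])
  have "(\<exists>r>0. mball x r \<subseteq> U) \<longleftrightarrow> (\<exists>p. \<forall>y\<in>\<Sigma>. (\<forall>i<p. x i = y i) \<longrightarrow> y \<in> U)"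
    if "x \<in> \<Sigma>" for x
  proof
    assume "\<exists>r>0. mball x r \<subseteq> U"
    then obtain r where r: "r > 0" "mball x r \<subseteq> U" by blast
    obtain p where "l ^ p < r" using real_arch_pow_inv[OF r(1) l(2)] by blast
    then have "y \<in> U" if "y \<in> \<Sigma>" "\<forall>i<p. x i = y i" for y
      using that r(2) \<open>x \<in> \<Sigma>\<close> seq_dist_le_iff_agree[OF l, of x y p] by (auto simp: in_mball)
    then show "\<exists>p. \<forall>y\<in>\<Sigma>. (\<forall>i<p. x i = y i) \<longrightarrow> y \<in> U" by blast
  next
    assume "\<exists>p. \<forall>y\<in>\<Sigma>. (\<forall>i<p. x i = y i) \<longrightarrow> y \<in> U"
    then obtain p where "\<forall>y\<in>\<Sigma>. (\<forall>i<p. x i = y i) \<longrightarrow> y \<in> U" by blast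
    then have "mball x (l ^ p) \<subseteq> U"
      using seq_dist_le_iff_agree[OF l, of x _ p] by (auto simp: in_mball dest!: less_imp_le)
    then show "\<exists>r>0. mball x r \<subseteq> U" using l by (intro exI[of _ "l ^ p"]) auto
  qed
  then show ?thesis unfolding shift_topology_def openin_mtopology by blast
qed

lemma topspace_shift_topology:
  assumes "0 < l" "l < 1" shows "topspace (shift_topology l \<Sigma>) = \<Sigma>"
proof -
  interpret Metric_space \<Sigma> "seq_dist l" by (rule Metric_space_seq_dist[OF assms])
  show ?thesis by (simp add: shift_topology_def)
qed

lemma
  assumes "0 < l" "l < 1"
  shows space_shift_borel: "space (shift_borel l \<Sigma>) = \<Sigma>"
    and sets_shift_borel_open: "openin (shift_topology l \<Sigma>) U \<Longrightarrow> U \<in> sets (shift_borel l \<Sigma>)"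
    and sets_shift_borel:
      "sets (shift_borel l \<Sigma>) = sigma_sets \<Sigma> {U. openin (shift_topology l \<Sigma>) U}"
proof -
  have "{U. openin (shift_topology l \<Sigma>) U} \<subseteq> Pow \<Sigma>"
    using openin_subset[of "shift_topology l \<Sigma>"] topspace_shift_topology[OF assms, of \<Sigma>] by auto
  then show "space (shift_borel l \<Sigma>) = \<Sigma>"
    and *: "sets (shift_borel l \<Sigma>) = sigma_sets \<Sigma> {U. openin (shift_topology l \<Sigma>) U}"
    by (simp_all add: shift_borel_def space_measure_of sets_measure_of)
  show "openin (shift_topology l \<Sigma>) U \<Longrightarrow> U \<in> sets (shift_borel l \<Sigma>)"
    unfolding * by auto
qed

lemma continuous_map_imp_shift_borel_measurable:
  assumes l: "0 < l" "l < 1" and f: "continuous_map (shift_topology l \<Sigma>) euclidean f"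
  shows "f \<in> borel_measurable (shift_borel l \<Sigma>)"
proof (rule borel_measurableI)
  fix S :: "'b set" assume "open S"
  then have "openin (shift_topology l \<Sigma>) {x \<in> topspace (shift_topology l \<Sigma>). f x \<in> S}"
    using f by (auto intro: openin_continuous_map_preimage)
  moreover have "{x \<in> topspace (shift_topology l \<Sigma>). f x \<in> S} = f -` S \<inter> space (shift_borel l \<Sigma>)"
    by (auto simp: topspace_shift_topology[OF l] space_shift_borel[OF l])
  ultimately show "f -` S \<inter> space (shift_borel l \<Sigma>) \<in> sets (shift_borel l \<Sigma>)"
    using sets_shift_borel_open[OF l] by metis
qed

lemma sft_shift_closed:
  assumes "subshift_of_finite_type \<Sigma>" shows "shift ` \<Sigma> \<subseteq> \<Sigma>"
proof -
  have *: "map (shift x) [i..<i + length w] = map x [Suc i..<Suc i + length w]"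
    for i and w :: "'a list" and x
    by (intro nth_equalityI) (auto simp: shift_def simp del: upt_Suc)
  from assms show ?thesis
    unfolding subshift_of_finite_type_def by (auto simp only: * mem_Collect_eq)
qed

lemma shift_funpow_closed:
  assumes "shift ` \<Sigma> \<subseteq> \<Sigma>" "x \<in> \<Sigma>" shows "(shift ^^ j) x \<in> \<Sigma>"
  using assms by (induction j) auto

lemma shift_measurable:
  assumes l: "0 < l" "l < 1" and closed: "shift ` \<Sigma> \<subseteq> \<Sigma>"
  shows "shift \<in> measurable (shift_borel l \<Sigma>) (shift_borel l \<Sigma>)"
proof (rule measurable_sigma_sets[OF sets_shift_borel[OF l]])
  show "{U. openin (shift_topology l \<Sigma>) U} \<subseteq> Pow \<Sigma>"
    using openin_shift_topology[OF l] by blast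
  show "shift \<in> space (shift_borel l \<Sigma>) \<rightarrow> \<Sigma>"
    using closed by (auto simp: space_shift_borel[OF l])
  fix U assume "U \<in> {U. openin (shift_topology l \<Sigma>) U}"
  then have U: "\<forall>x\<in>U. \<exists>p. \<forall>y\<in>\<Sigma>. (\<forall>i<p. x i = y i) \<longrightarrow> y \<in> U"
    unfolding openin_shift_topology[OF l] mem_Collect_eq by (rule conjunct2)
  have "openin (shift_topology l \<Sigma>) (shift -` U \<inter> \<Sigma>)"
    unfolding openin_shift_topology[OF l]
  proof (intro conjI ballI)
    fix x assume x: "x \<in> shift -` U \<inter> \<Sigma>"
    then obtain p where p: "\<forall>y\<in>\<Sigma>. (\<forall>i<p. shift x i = y i) \<longrightarrow> y \<in> U" using U by blast
    have "shift y \<in> U" if "y \<in> \<Sigma>" "\<forall>i<Suc p. x i = y i" for y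
      using that closed by (intro p[rule_format]) (auto simp: shift_def)
    then show "\<exists>p. \<forall>y\<in>\<Sigma>. (\<forall>i<p. x i = y i) \<longrightarrow> y \<in> shift -` U \<inter> \<Sigma>"
      by (intro exI[of _ "Suc p"]) auto
  qed auto
  then show "shift -` U \<inter> space (shift_borel l \<Sigma>) \<in> sets (shift_borel l \<Sigma>)"
    using sets_shift_borel_open[OF l] by (simp add: space_shift_borel[OF l])
qed

definition cylinder :: "(nat \<Rightarrow> 'a) set \<Rightarrow> 'a list \<Rightarrow> (nat \<Rightarrow> 'a) set" where
  "cylinder \<Sigma> w = {x \<in> \<Sigma>. \<forall>i<length w. x i = w ! i}"

lemma cylinder_measurable:
  assumes "0 < l" "l < 1" shows "cylinder \<Sigma> w \<in> sets (shift_borel l \<Sigma>)"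
  by (rule sets_shift_borel_open[OF assms], unfold openin_shift_topology[OF assms])
     (auto simp: cylinder_def intro!: exI[of _ "length w"])

lemma mem_cylinder_prefix: "x \<in> \<Sigma> \<Longrightarrow> x \<in> cylinder \<Sigma> (map x [0..<p])"
  by (simp add: cylinder_def)

text \<open>
  As there are finitely many words of length \<open>p\<close>, this cover replaces compactness of \<open>\<Sigma>\<close>: what
  holds on each cylinder of a fixed length, such as finiteness or boundedness of the values of a
  function, holds on \<open>\<Sigma>\<close>.
\<close>

lemma image_cover_cylinders:
  "f ` \<Sigma> \<subseteq> (\<Union>w\<in>{w. length w = p}. f ` cylinder \<Sigma> w)"
proof
  fix v assume "v \<in> f ` \<Sigma>"
  then obtain x where x: "x \<in> \<Sigma>" "v = f x" by blast
  show "v \<in> (\<Union>w\<in>{w. length w = p}. f ` cylinder \<Sigma> w)"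
  proof (rule UN_I)
    show "v \<in> f ` cylinder \<Sigma> (map x [0..<p])" using mem_cylinder_prefix x by blast
  qed simp
qed

lemma finite_words: "finite {w :: 'a::finite list. length w = p}"
  using finite_lists_length_eq[of "UNIV :: 'a set" p] by simp

lemma locally_constant_finite_image:
  fixes \<Sigma> :: "(nat \<Rightarrow> 'a::finite) set"
  assumes "locally_constant \<Sigma> g" shows "finite (g ` \<Sigma>)"
proof -
  obtain j where j: "\<forall>x\<in>\<Sigma>. \<forall>y\<in>\<Sigma>. (\<forall>i\<le>j. x i = y i) \<longrightarrow> g x = g y"
    using assms unfolding locally_constant_def by (rule exE)
  have "finite (g ` cylinder \<Sigma> w)" if w: "length w = Suc j" for w
  proof (cases "cylinder \<Sigma> w = {}")
    case False
    then obtain x where x: "x \<in> cylinder \<Sigma> w" by blast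
    have "g y = g x" if "y \<in> cylinder \<Sigma> w" for y
      using x that w by (intro j[rule_format]) (auto simp: cylinder_def)
    then have "g ` cylinder \<Sigma> w \<subseteq> {g x}" by blast
    then show ?thesis by (rule finite_subset) simp
  qed simp
  then show ?thesis
    by (intro finite_subset[OF image_cover_cylinders[of g \<Sigma> "Suc j"]] finite_UN_I finite_words) simp
qed

section \<open>Walters functions\<close>

lemma bowen_dist_le:
  assumes l: "0 < l" "l < 1" and "k > 0" and agree: "\<And>i. i < k + p \<Longrightarrow> x i = y i"
  shows "bowen_dist l k x y \<le> l ^ p"
proof -
  have "seq_dist l ((shift ^^ j) x) ((shift ^^ j) y) \<le> l ^ p" if "j < k" for j
    using that agree by (auto simp: seq_dist_le_iff_agree[OF l] shift_funpow)
  then show ?thesis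
    unfolding bowen_dist_def using \<open>k > 0\<close> by (subst Max_le_iff) auto
qed

text \<open>
  Agreement on \<open>k + p\<close> coordinates bounds the Bowen distance by \<open>l\<^sup>p\<close> whatever \<open>k\<close> is, and the
  modulus of a Walters function tends to \<open>0\<close> there.
\<close>

lemma walters_uniform:
  assumes l: "0 < l" "l < 1" and "walters l \<Sigma> f" "0 < e"
  shows "\<exists>p0. \<forall>p\<ge>p0. \<forall>k>0. \<forall>x\<in>\<Sigma>. \<forall>y\<in>\<Sigma>. (\<forall>i<k + p. x i = y i) \<longrightarrow>
    \<bar>birkhoff_sum k f x - birkhoff_sum k f y\<bar> \<le> e"
proof -
  obtain H :: "real \<Rightarrow> ennreal" where H0: "H 0 = 0" and cont: "continuous (at 0 within {0..}) H"
    and H: "\<forall>s\<ge>0. \<forall>k>0. \<forall>x\<in>\<Sigma>. \<forall>y\<in>\<Sigma>. bowen_dist l k x y \<le> s \<longrightarrow>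
      ennreal \<bar>birkhoff_sum k f x - birkhoff_sum k f y\<bar> \<le> H s"
    using assms(3) unfolding walters_def by (elim exE conjE)
  have "\<forall>\<^sub>F s in at 0 within {0..}. H s < ennreal e"
    using cont H0 \<open>0 < e\<close> by (intro order_tendstoD(2)[of H 0]) (auto simp: continuous_within)
  then obtain d where d: "d > 0" "\<And>s. 0 \<le> s \<Longrightarrow> s \<noteq> 0 \<Longrightarrow> \<bar>s\<bar> < d \<Longrightarrow> H s < ennreal e"
    unfolding eventually_at by (auto simp: dist_real_def)
  obtain p0 where p0: "l ^ p0 < d" using real_arch_pow_inv[OF d(1) l(2)] by blast
  show ?thesis
  proof (intro exI[of _ p0] allI impI ballI)
    fix p k x y assume p: "p0 \<le> p" and k: "0 < k" and xy: "x \<in> \<Sigma>" "y \<in> \<Sigma>"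
      and agree: "\<forall>i<k + p. x i = y i"
    have "l ^ p < d" using power_decreasing[OF p, of l] p0 l by linarith
    then have "H (l ^ p) < ennreal e" using l by (intro d) auto
    moreover have "ennreal \<bar>birkhoff_sum k f x - birkhoff_sum k f y\<bar> \<le> H (l ^ p)"
      using k xy l agree bowen_dist_le[OF l k, of p x y] by (intro H[rule_format]) auto
    ultimately have "ennreal \<bar>birkhoff_sum k f x - birkhoff_sum k f y\<bar> < ennreal e"
      by (rule le_less_trans[rotated])
    then show "\<bar>birkhoff_sum k f x - birkhoff_sum k f y\<bar> \<le> e" 
      using \<open>0 < e\<close> by (simp add: ennreal_less_iff)
  qed
qed

text \<open>For \<open>k = 1\<close>, the uniform estimate bounds the oscillation on each cylinder of a fixed length.\<close>

lemma walters_bounded: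
  fixes \<Sigma> :: "(nat \<Rightarrow> 'a::finite) set"
  assumes l: "0 < l" "l < 1" and "walters l \<Sigma> f"
  shows "bounded (f ` \<Sigma>)"
proof -
  obtain p where p: "\<forall>q\<ge>p. \<forall>k>0. \<forall>x\<in>\<Sigma>. \<forall>y\<in>\<Sigma>. (\<forall>i<k + q. x i = y i) \<longrightarrow>
      \<bar>birkhoff_sum k f x - birkhoff_sum k f y\<bar> \<le> 1"
    using walters_uniform[OF assms zero_less_one] by (rule exE)
  have "bounded (f ` cylinder \<Sigma> w)" if w: "length w = Suc p" for w
  proof (cases "cylinder \<Sigma> w = {}")
    case False
    then obtain x where x: "x \<in> cylinder \<Sigma> w" by blast
    have "dist (f x) (f y) \<le> 1" if "y \<in> cylinder \<Sigma> w" for y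
      using p[rule_format, of p 1 x y] x that w by (simp add: cylinder_def birkhoff_sum_def dist_real_def)
    then show ?thesis unfolding bounded_def by blast
  qed simp
  then show ?thesis
    by (intro bounded_subset[OF _ image_cover_cylinders[of f \<Sigma> "Suc p"]] bounded_UN finite_words) simp
qed

section \<open>Periodic points and their measures\<close>

text \<open>
  If \<open>p\<close> is at least the length of every forbidden word, then each window of such a length in the
  periodic point starting at \<open>i\<close> already occurs in \<open>z\<close> at position \<open>i mod L\<close>. The argument covers
  \<open>L < p\<close> too, where the returning prefix overlaps itself and \<open>z\<close> is \<open>L\<close>-periodic on its first
  \<open>L + p\<close> coordinates.
\<close>

lemma sft_closing:
  assumes "subshift_of_finite_type \<Sigma>"
  shows "\<exists>p0. \<forall>p\<ge>p0. \<forall>L>0. \<forall>z\<in>\<Sigma>. (\<forall>i<p. z (L + i) = z i) \<longrightarrow>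
    (\<exists>y\<in>\<Sigma>. (shift ^^ L) y = y \<and> (\<forall>i<L + p. y i = z i))"
proof -
  obtain F where F: "finite F" "\<Sigma> = {x. \<forall>w\<in>F. \<forall>i. map x [i..<i + length w] \<noteq> w}"
    using assms unfolding subshift_of_finite_type_def by blast
  obtain p0 where p0: "\<And>w. w \<in> F \<Longrightarrow> length w \<le> p0"
    using finite_maxlen[OF F(1)] less_imp_le by blast
  show ?thesis
  proof (intro exI[of _ p0] allI impI ballI)
    fix p L and z :: "nat \<Rightarrow> 'a"
    assume p: "p0 \<le> p" and L: "0 < L" and z: "z \<in> \<Sigma>"
      and recur: "\<forall>i<p. z (L + i) = z i"
    define y where "y = (\<lambda>i. z (i mod L))"
    have y_z: "y i = z i" if "i < L + p" for i
      using that
    proof (induction i rule: less_induct)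
      case (less i)
      show ?case
      proof (cases "i < L")
        case False
        then have "z i = z (i - L)" using recur[rule_format, of "i - L"] less.prems by simp
        also have "\<dots> = y (i - L)" using less.IH[of "i - L"] False L less.prems by simp
        also have "\<dots> = y i" using False by (simp add: y_def le_mod_geq)
        finally show ?thesis by simp
      qed (simp add: y_def)
    qed
    have "map y [i..<i + length w] \<noteq> w" if w: "w \<in> F" for i w
    proof -
      have "map y [i..<i + length w] = map z [i mod L..<i mod L + length w]"
      proof (rule nth_equalityI)
        fix k assume "k < length (map y [i..<i + length w])"
        then have k: "k < length w" by simp
        have "y (i + k) = y (i mod L + k)" by (simp add: y_def mod_simps)
        also have "\<dots> = z (i mod L + k)"
          using k p0[OF w] p L mod_less_divisor[OF L, of i] by (intro y_z) linarith
        finally show "map y [i..<i + length w] ! k = map z [i mod L..<i mod L + length w] ! k"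
          using k by simp
      qed simp
      with z w show ?thesis unfolding F(2) by auto
    qed
    then have "y \<in> \<Sigma>" unfolding F(2) by blast
    moreover have "(shift ^^ L) y = y" by (simp add: shift_funpow y_def)
    ultimately show "\<exists>y\<in>\<Sigma>. (shift ^^ L) y = y \<and> (\<forall>i<L + p. y i = z i)" using y_z by blast
  qed
qed

text \<open>
  The push-forward of the uniform distribution on the time indices: probability, integrals and
  measurability are then inherited from \<^const>\<open>distr\<close> and \<^const>\<open>pmf_of_set\<close>.
\<close>

definition orbit_measure :: "real \<Rightarrow> (nat \<Rightarrow> 'a) set \<Rightarrow> nat \<Rightarrow> (nat \<Rightarrow> 'a) \<Rightarrow> (nat \<Rightarrow> 'a) measure" where
  "orbit_measure l \<Sigma> M x =
     distr (measure_pmf (pmf_of_set {..<M})) (shift_borel l \<Sigma>) (\<lambda>j. (shift ^^ j) x)"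

context
  fixes l :: real and \<Sigma> :: "(nat \<Rightarrow> 'a) set" and x :: "nat \<Rightarrow> 'a" and M :: nat
  assumes l: "0 < l" "l < 1" and closed: "shift ` \<Sigma> \<subseteq> \<Sigma>"
    and x: "x \<in> \<Sigma>" and M: "0 < M"
begin

lemma orbit_measurable:
  "(\<lambda>j. (shift ^^ j) x) \<in> measurable (measure_pmf q) (shift_borel l \<Sigma>)"
  using shift_funpow_closed[OF closed x] by (simp add: space_shift_borel[OF l])

lemma integral_orbit_measure:
  fixes f :: "(nat \<Rightarrow> 'a) \<Rightarrow> real"
  assumes "f \<in> borel_measurable (shift_borel l \<Sigma>)"
  shows "(\<integral>y. f y \<partial>orbit_measure l \<Sigma> M x) = birkhoff_sum M f x / real M"
  unfolding orbit_measure_def using M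
  by (subst integral_distr[OF orbit_measurable assms], subst integral_pmf_of_set)
     (auto simp: birkhoff_sum_def)

lemma measure_orbit_measure:
  assumes "B \<in> sets (shift_borel l \<Sigma>)"
  shows "measure (orbit_measure l \<Sigma> M x) B = birkhoff_sum M (indicat_real B) x / real M"
proof -
  interpret prob_space "orbit_measure l \<Sigma> M x"
    unfolding orbit_measure_def
    by (rule prob_space.prob_space_distr[OF prob_space_measure_pmf orbit_measurable])
  have "B \<subseteq> space (orbit_measure l \<Sigma> M x)"
    using sets.sets_into_space[OF assms] by (simp add: orbit_measure_def)
  then show ?thesis
    using integral_orbit_measure[of "indicat_real B"] assms
    by (simp add: Int_absorb2)
qed

lemma orbit_measure_invariant:
  assumes per: "(shift ^^ M) x = x"
  shows "orbit_measure l \<Sigma> M x \<in> invariant_measures l \<Sigma>"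
proof -
  let ?\<mu> = "orbit_measure l \<Sigma> M x"
  have s: "sets ?\<mu> = sets (shift_borel l \<Sigma>)" "space ?\<mu> = \<Sigma>"
    by (simp_all add: orbit_measure_def space_shift_borel[OF l])
  have "measure ?\<mu> (shift -` B \<inter> \<Sigma>) = measure ?\<mu> B" if B: "B \<in> sets (shift_borel l \<Sigma>)" for B
  proof -
    have pre: "shift -` B \<inter> \<Sigma> \<in> sets (shift_borel l \<Sigma>)"
      using measurable_sets[OF shift_measurable[OF l closed] B] by (simp add: space_shift_borel[OF l])
    let ?h = "\<lambda>j. indicat_real B ((shift ^^ j) x)"
    have "birkhoff_sum M (indicat_real (shift -` B \<inter> \<Sigma>)) x = (\<Sum>j<M. ?h (Suc j))"
      unfolding birkhoff_sum_def
      using shift_funpow_closed[OF closed x] by (intro sum.cong) (auto simp: indicator_def)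
    also have "\<dots> = (\<Sum>j<Suc M. ?h j) - ?h 0"
      by (simp add: sum.lessThan_Suc_shift del: sum.lessThan_Suc)
    also have "\<dots> = birkhoff_sum M (indicat_real B) x"
      using per by (simp add: birkhoff_sum_def)
    finally show ?thesis using measure_orbit_measure[OF B] measure_orbit_measure[OF pre] by simp
  qed
  moreover have "prob_space ?\<mu>"
    unfolding orbit_measure_def
    by (rule prob_space.prob_space_distr[OF prob_space_measure_pmf orbit_measurable])
  ultimately show ?thesis unfolding invariant_measures_def by (simp add: s)
qed

lemma orbit_measure_periodic:
  assumes per: "(shift ^^ M) x = x"
  shows "periodic_measure l \<Sigma> (orbit_measure l \<Sigma> M x)"
proof -
  have "emeasure (orbit_measure l \<Sigma> M x) B =
      (\<Sum>j<M. emeasure (return (shift_borel l \<Sigma>) ((shift ^^ j) x)) B) / of_nat M"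
    if B: "B \<in> sets (shift_borel l \<Sigma>)" for B
  proof -
    have "emeasure (orbit_measure l \<Sigma> M x) B =
        (\<integral>\<^sup>+j. indicator B ((shift ^^ j) x) \<partial>measure_pmf (pmf_of_set {..<M}))"
      unfolding orbit_measure_def
      using B by (subst nn_integral_distr[OF orbit_measurable, symmetric]) auto
    also have "\<dots> = (\<Sum>j<M. indicator B ((shift ^^ j) x)) / of_nat M"
      using M by (subst nn_integral_pmf_of_set) auto
    finally show ?thesis using B by simp
  qed
  then show ?thesis
    unfolding periodic_measure_def using x M per
    by (auto simp: orbit_measure_def)
qed

end

section \<open>Rationality\<close>

lemma common_denominator:
  fixes S :: "real set"
  assumes "finite S" "S \<subseteq> \<rat>"
  obtains q :: nat where "0 < q" "\<And>s. s \<in> S \<Longrightarrow> real q * s \<in> \<int>"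
proof -
  have "\<exists>q::nat. 0 < q \<and> (\<forall>s\<in>S. real q * s \<in> \<int>)"
    using assms
  proof (induction S rule: finite_induct)
    case (insert s S)
    then obtain q :: nat where q: "0 < q" "\<forall>s\<in>S. real q * s \<in> \<int>" by auto
    from insert.prems obtain a b :: int where b: "b > 0" "s = of_int a / of_int b"
      by (auto elim!: Rats_cases')
    have "real (q * nat b) * s = of_int (int q * a)" using b by simp
    then have "real (q * nat b) * s \<in> \<int>" by (metis Ints_of_int)
    moreover have "real (q * nat b) * t \<in> \<int>" if "t \<in> S" for t
    proof -
      have "real (q * nat b) * t = real (nat b) * (real q * t)" by simp
      then show ?thesis using q that by (metis Ints_mult Ints_of_nat)
    qed
    ultimately show ?case using q b by (intro exI[of _ "q * nat b"]) auto
  qed (auto intro: exI[of _ 1])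
  then show ?thesis using that by blast
qed

text \<open>
  A common denominator \<open>q\<close> of the coordinates of \<open>r\<close> and of the finitely many values of \<open>\<phi>\<close> confines
  all coordinates of \<open>S\<^sub>L \<phi>(z) - L r\<close> to \<open>q\<^sup>-\<^sup>1 \<int>\<close>.
\<close>

lemma rational_cocycle_discrete:
  fixes \<phi> :: "(nat \<Rightarrow> 'a) \<Rightarrow> real ^ 'n"
  assumes fin: "finite (\<phi> ` \<Sigma>)" and closed: "shift ` \<Sigma> \<subseteq> \<Sigma>"
    and rat: "\<forall>x\<in>\<Sigma>. \<forall>i. \<phi> x $ i \<in> \<rat>" "\<forall>i. r $ i \<in> \<rat>"
  shows "\<exists>e>0. \<forall>z\<in>\<Sigma>. \<forall>L. norm (birkhoff_sum L \<phi> z - real L *\<^sub>R r) < e \<longrightarrow>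
      birkhoff_sum L \<phi> z = real L *\<^sub>R r"
proof -
  let ?S = "(\<Union>i. (\<lambda>v. v $ i) ` (insert r (\<phi> ` \<Sigma>)))"
  have "finite ?S" "?S \<subseteq> \<rat>" using fin rat by auto
  then obtain q :: nat where q: "0 < q" "\<And>s. s \<in> ?S \<Longrightarrow> real q * s \<in> \<int>"
    by (rule common_denominator) blast
  show ?thesis
  proof (intro exI[of _ "1 / real q"] conjI ballI allI impI)
    show "0 < 1 / real q" using q by simp
    fix L z assume z: "z \<in> \<Sigma>" and small: "norm (birkhoff_sum L \<phi> z - real L *\<^sub>R r) < 1 / real q"
    let ?v = "birkhoff_sum L \<phi> z - real L *\<^sub>R r"
    have "?v $ i = 0" for i
    proof -
      have "real q * ?v $ i = (\<Sum>j<L. real q * \<phi> ((shift ^^ j) z) $ i) - real L * (real q * r $ i)"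
        by (simp add: birkhoff_sum_def algebra_simps sum_distrib_left)
      also have "\<dots> \<in> \<int>"
        using shift_funpow_closed[OF closed z] by (intro Ints_diff Ints_sum Ints_mult q(2)) auto
      finally have int: "real q * ?v $ i \<in> \<int>" .
      have "\<bar>?v $ i\<bar> < 1 / real q" using component_le_norm_cart[of ?v i] small by linarith
      then have "\<bar>real q * ?v $ i\<bar> < 1"
        using q(1) by (simp add: abs_mult pos_less_divide_eq mult.commute del: vector_minus_component)
      with int have "real q * ?v $ i = 0" using Ints_nonzero_abs_less1 by blast
      then show ?thesis using q(1) by simp
    qed
    then have "?v = 0" by (simp add: vec_eq_iff)
    then show "birkhoff_sum L \<phi> z = real L *\<^sub>R r" by simp
  qed
qed

section \<open>Approximation by periodic measures\<close>

text \<open>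
  If the return set were not measurable, its \<^const>\<open>measure\<close> would be \<open>0\<close> by convention; joint
  recurrence then says that \<open>D\<close> is null, and the claim still holds.
\<close>

lemma joint_recurrent_AE:
  fixes \<nu> :: "(nat \<Rightarrow> 'a) measure"
  assumes "prob_space \<nu>" and jr: "joint_recurrent \<phi> \<nu>" and D: "D \<in> sets \<nu>"
  shows "AE z in \<nu>. z \<in> D \<longrightarrow> z \<in> return_set \<phi> \<nu> D"
proof -
  interpret prob_space \<nu> by fact
  let ?R = "return_set \<phi> \<nu> D"
  have eq: "measure \<nu> ?R = measure \<nu> D" using jr D unfolding joint_recurrent_def by blast
  have sub: "?R \<subseteq> D" unfolding return_set_def by blast
  show ?thesis
  proof (cases "?R \<in> sets \<nu>")
    case True
    then have "measure \<nu> (D - ?R) = 0" using finite_measure_Diff[OF D True sub] eq by simp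
    then have "AE z in \<nu>. z \<notin> D - ?R"
      using D True by (intro AE_not_in) (simp add: null_sets_def emeasure_eq_measure)
    then show ?thesis by eventually_elim blast
  next
    case False
    then have "measure \<nu> D = 0" using eq by (simp add: measure_notin_sets)
    then have "AE z in \<nu>. z \<notin> D"
      using D by (intro AE_not_in) (simp add: null_sets_def emeasure_eq_measure)
    then show ?thesis by auto
  qed
qed

lemma distr_shift_invariant:
  assumes l: "0 < l" "l < 1" and closed: "shift ` \<Sigma> \<subseteq> \<Sigma>"
    and \<nu>: "\<nu> \<in> invariant_measures l \<Sigma>"
  shows "shift \<in> measurable \<nu> \<nu>" "distr \<nu> \<nu> shift = \<nu>"
proof -
  have s: "sets \<nu> = sets (shift_borel l \<Sigma>)" and "prob_space \<nu>"
    and inv: "\<And>B. B \<in> sets \<nu> \<Longrightarrow> measure \<nu> (shift -` B \<inter> space \<nu>) = measure \<nu> B"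
    using \<nu> unfolding invariant_measures_def by auto
  interpret prob_space \<nu> by fact
  show m: "shift \<in> measurable \<nu> \<nu>"
    using shift_measurable[OF l closed] measurable_cong_sets[OF s s] by blast
  show "distr \<nu> \<nu> shift = \<nu>"
    by (rule measure_eqI) (auto simp: emeasure_distr[OF m] emeasure_eq_measure inv)
qed

lemma periodic_approximation:
  fixes \<Sigma> :: "(nat \<Rightarrow> 'a::finite) set" and \<phi> :: "(nat \<Rightarrow> 'a) \<Rightarrow> real ^ 'n"
  assumes l: "0 < l" "l < 1"
    and sft: "subshift_of_finite_type \<Sigma>"
    and cont: "continuous_map (shift_topology l \<Sigma>) euclidean \<phi>"
    and rat: "\<forall>x\<in>\<Sigma>. \<forall>i. \<phi> x $ i \<in> \<rat>" "\<forall>i. r $ i \<in> \<rat>"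
    and lc: "locally_constant \<Sigma> \<phi>"
    and A: "walters l \<Sigma> A"
    and \<nu>: "\<nu> \<in> rotation_fiber l \<Sigma> \<phi> r" "joint_recurrent \<phi> \<nu>"
    and e: "0 < e"
  obtains \<mu> where "\<mu> \<in> rotation_fiber l \<Sigma> \<phi> r" "periodic_measure l \<Sigma> \<mu>"
    "(\<integral>x. A x \<partial>\<nu>) - e \<le> (\<integral>x. A x \<partial>\<mu>)"
proof -
  note closed = sft_shift_closed[OF sft]
  have inv: "\<nu> \<in> invariant_measures l \<Sigma>" and rot: "rotation \<phi> \<nu> = r"
    using \<nu>(1) by (auto simp: rotation_fiber_def)
  have s: "sets \<nu> = sets (shift_borel l \<Sigma>)" and prob: "prob_space \<nu>"
    using inv by (auto simp: invariant_measures_def)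
  interpret prob_space \<nu> by fact
  have space: "space \<nu> = \<Sigma>" using sets_eq_imp_space_eq[OF s] by (simp add: space_shift_borel[OF l])
  have A_meas: "A \<in> borel_measurable (shift_borel l \<Sigma>)"
    using A continuous_map_imp_shift_borel_measurable[OF l] by (auto simp: walters_def)
  have A_int: "integrable \<nu> A"
  proof -
    obtain b where "\<And>x. x \<in> \<Sigma> \<Longrightarrow> norm (A x) \<le> b"
      using walters_bounded[OF l A] by (auto simp: bounded_iff)
    then show ?thesis
      using A_meas by (intro integrable_const_bound[of _ b])
        (auto simp: space measurable_cong_sets[OF s refl])
  qed
  obtain d where d: "0 < d" "\<forall>z\<in>\<Sigma>. \<forall>L. norm (birkhoff_sum L \<phi> z - real L *\<^sub>R r) < d \<longrightarrow>
      birkhoff_sum L \<phi> z = real L *\<^sub>R r"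
    using rational_cocycle_discrete[OF locally_constant_finite_image[OF lc] closed rat]
    by (elim exE conjE)
  obtain p1 where p1: "\<forall>p\<ge>p1. \<forall>L>0. \<forall>z\<in>\<Sigma>. (\<forall>i<p. z (L + i) = z i) \<longrightarrow>
      (\<exists>y\<in>\<Sigma>. (shift ^^ L) y = y \<and> (\<forall>i<L + p. y i = z i))"
    using sft_closing[OF sft] by (rule exE)
  obtain p2 where p2: "\<forall>p\<ge>p2. \<forall>k>0. \<forall>x\<in>\<Sigma>. \<forall>y\<in>\<Sigma>. (\<forall>i<k + p. x i = y i) \<longrightarrow>
      \<bar>birkhoff_sum k A x - birkhoff_sum k A y\<bar> \<le> e / 2"
    using walters_uniform[OF l A half_gt_zero[OF e]] by (rule exE)
  obtain p3 where p3: "\<forall>x\<in>\<Sigma>. \<forall>y\<in>\<Sigma>. (\<forall>i\<le>p3. x i = y i) \<longrightarrow> \<phi> x = \<phi> y"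
    using lc unfolding locally_constant_def by (rule exE)
  define p where "p = p1 + p2 + p3"
  define b where "b = (\<integral>x. A x \<partial>\<nu>)"
  \<comment> \<open>The cylinder depends on the point, but it ranges over a finite set, so one null set suffices.\<close>
  have rec: "AE z in \<nu>. \<forall>w\<in>{w. length w = p}. z \<in> cylinder \<Sigma> w \<longrightarrow> z \<in> return_set \<phi> \<nu> (cylinder \<Sigma> w)"
    using joint_recurrent_AE[OF prob \<nu>(2)] cylinder_measurable[OF l, of \<Sigma>]
    by (intro AE_finite_allI finite_words) (auto simp: s)
  \<comment> \<open>The bound \<open>above\<close> holds for all \<open>L\<close>, so no return time has to be known in advance.\<close>
  obtain z where z: "z \<in> \<Sigma>" "z \<in> return_set \<phi> \<nu> (cylinder \<Sigma> (map z [0..<p]))"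
    and above: "\<And>L. 0 < L \<Longrightarrow> real L * (b - e / 2) \<le> birkhoff_sum L A z"
  proof -
    let ?g = "\<lambda>x. b - e / 2 - A x"
    have sum_g: "(\<Sum>j<L. ?g ((shift ^^ j) x)) = real L * (b - e / 2) - birkhoff_sum L A x" for L x
      by (simp add: birkhoff_sum_def sum_subtractf)
    have "\<not> (AE x in \<nu>. \<exists>L>0. 0 < (\<Sum>j<L. ?g ((shift ^^ j) x)))"
    proof
      assume "AE x in \<nu>. \<exists>L>0. 0 < (\<Sum>j<L. ?g ((shift ^^ j) x))"
      then have "0 \<le> (\<integral>x. ?g x \<partial>\<nu>)"
        using A_int by (intro maximal_ergodic_inequality[OF distr_shift_invariant[OF l closed inv]]) auto
      also have "\<dots> = - e / 2" using A_int by (simp add: prob_space b_def)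
      finally show False using e by simp
    qed
    moreover have "AE x in \<nu>. \<exists>L>0. 0 < (\<Sum>j<L. ?g ((shift ^^ j) x))"
      if none: "\<And>x. x \<in> \<Sigma> \<Longrightarrow> x \<in> return_set \<phi> \<nu> (cylinder \<Sigma> (map x [0..<p])) \<Longrightarrow>
        \<exists>L>0. birkhoff_sum L A x < real L * (b - e / 2)"
      using rec AE_space
    proof eventually_elim
      case (elim x)
      then show ?case
        using mem_cylinder_prefix[of x \<Sigma> p] none[of x] unfolding sum_g by (simp add: space)
    qed
    ultimately show ?thesis using that by (meson not_le)
  qed
  from z(2) d(1) obtain L where L: "0 < L" "(shift ^^ L) z \<in> cylinder \<Sigma> (map z [0..<p])"
    "norm (birkhoff_sum L \<phi> z - real L *\<^sub>R r) < d"
    unfolding return_set_def rot by blast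
  have recur: "z (L + i) = z i" if "i < p" for i
    using L(2) that by (simp add: cylinder_def shift_funpow add.commute[of L])
  obtain y where y: "y \<in> \<Sigma>" "(shift ^^ L) y = y" "\<And>i. i < L + p \<Longrightarrow> y i = z i"
    using p1[rule_format, of p L z] L(1) z(1) recur by (auto simp: p_def)
  have phi_y: "birkhoff_sum L \<phi> y = real L *\<^sub>R r"
  proof -
    have "birkhoff_sum L \<phi> y = birkhoff_sum L \<phi> z"
      unfolding birkhoff_sum_def
    proof (rule sum.cong)
      fix j assume "j \<in> {..<L}"
      then show "\<phi> ((shift ^^ j) y) = \<phi> ((shift ^^ j) z)"
        using shift_funpow_closed[OF closed] y(1) z(1)
        by (intro p3[rule_format]) (auto simp: shift_funpow p_def intro!: y(3))
    qed simp
    then show ?thesis using d(2) z(1) L(3) by simp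
  qed
  let ?\<mu> = "orbit_measure l \<Sigma> L y"
  have rot_mu: "rotation \<phi> ?\<mu> = r"
  proof -
    have "(\<integral>x. \<phi> x $ i \<partial>?\<mu>) = r $ i" for i
    proof -
      have "continuous_map (shift_topology l \<Sigma>) euclidean (\<lambda>x. \<phi> x $ i)"
        using continuous_map_compose[OF cont, of euclidean "\<lambda>v. v $ i"]
        by (simp add: o_def continuous_on_component)
      then have "(\<integral>x. \<phi> x $ i \<partial>?\<mu>) = birkhoff_sum L (\<lambda>x. \<phi> x $ i) y / real L"
        using integral_orbit_measure[OF l closed y(1) L(1)]
          continuous_map_imp_shift_borel_measurable[OF l] by blast
      also have "birkhoff_sum L (\<lambda>x. \<phi> x $ i) y = birkhoff_sum L \<phi> y $ i"
        by (simp add: birkhoff_sum_def)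
      finally show ?thesis using L(1) by (simp add: phi_y)
    qed
    then show ?thesis by (simp add: rotation_def vec_eq_iff)
  qed
  show ?thesis
  proof
    show "?\<mu> \<in> rotation_fiber l \<Sigma> \<phi> r"
      using orbit_measure_invariant[OF l closed y(1) L(1) y(2)] rot_mu by (simp add: rotation_fiber_def)
    show "periodic_measure l \<Sigma> ?\<mu>"
      by (rule orbit_measure_periodic[OF l closed y(1) L(1) y(2)])
    have "\<bar>birkhoff_sum L A y - birkhoff_sum L A z\<bar> \<le> e / 2"
      using y L(1) z(1) by (intro p2[rule_format, of p]) (auto simp: p_def)
    \<comment> \<open>The closing error does not grow with \<open>L\<close>, so \<open>L \<ge> 1\<close> suffices to absorb it in the average.\<close>
    also have "\<dots> \<le> real L * (e / 2)" using L(1) e by simp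
    finally have "\<bar>birkhoff_sum L A y - birkhoff_sum L A z\<bar> \<le> real L * (e / 2)" .
    moreover have "real L * (b - e) = real L * (b - e / 2) - real L * (e / 2)"
      by (simp add: algebra_simps)
    ultimately have "real L * (b - e) \<le> birkhoff_sum L A y"
      using above[OF L(1)] by linarith
    then have "b - e \<le> birkhoff_sum L A y / real L" using L(1) by (simp add: field_simps)
    then show "(\<integral>x. A x \<partial>\<nu>) - e \<le> (\<integral>x. A x \<partial>?\<mu>)"
      using integral_orbit_measure[OF l closed y(1) L(1) A_meas] by (simp add: b_def)
  qed
qed

theorem corollary12:
  fixes l :: real and \<Sigma> :: "(nat \<Rightarrow> 'a::finite) set"
    and \<phi> :: "(nat \<Rightarrow> 'a) \<Rightarrow> real ^ 'n" and A :: "(nat \<Rightarrow> 'a) \<Rightarrow> real" and r :: "real ^ 'n"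
  assumes "0 < l" and "l < 1"
    and "subshift_of_finite_type \<Sigma>"
    and "continuous_map (shift_topology l \<Sigma>) euclidean \<phi>"
    and "\<forall>x\<in>\<Sigma>. \<forall>i. \<phi> x $ i \<in> \<rat>"
    and "locally_constant \<Sigma> \<phi>"
    and "walters l \<Sigma> A"
    and "r \<in> rotation \<phi> ` invariant_measures l \<Sigma>"
    and "\<forall>i. r $ i \<in> \<rat>"
    and "\<exists>\<nu>. maximizing l \<Sigma> A \<phi> r \<nu> \<and> ergodic \<nu> \<and> joint_recurrent \<phi> \<nu>"
  shows "beta l \<Sigma> A \<phi> r =
    (SUP \<mu>\<in>{\<mu> \<in> rotation_fiber l \<Sigma> \<phi> r. periodic_measure l \<Sigma> \<mu>}. ereal (\<integral>x. A x \<partial>\<mu>))"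
proof (rule antisym)
  obtain \<nu> where \<nu>: "\<nu> \<in> rotation_fiber l \<Sigma> \<phi> r" "joint_recurrent \<phi> \<nu>"
    and max: "beta l \<Sigma> A \<phi> r = ereal (\<integral>x. A x \<partial>\<nu>)"
    using assms(10) by (auto simp: maximizing_def)
  let ?sup = "SUP \<mu>\<in>{\<mu> \<in> rotation_fiber l \<Sigma> \<phi> r. periodic_measure l \<Sigma> \<mu>}. ereal (\<integral>x. A x \<partial>\<mu>)"
  show "beta l \<Sigma> A \<phi> r \<le> ?sup"
    unfolding max
  proof (rule ereal_le_epsilon2)
    fix e :: real assume "0 < e"
    then obtain \<mu> where \<mu>: "\<mu> \<in> rotation_fiber l \<Sigma> \<phi> r" "periodic_measure l \<Sigma> \<mu>"
      and le: "(\<integral>x. A x \<partial>\<nu>) - e \<le> (\<integral>x. A x \<partial>\<mu>)"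
      using periodic_approximation[OF assms(1-5) assms(9) assms(6,7) \<nu>] by blast
    have "ereal (\<integral>x. A x \<partial>\<nu>) \<le> ereal (\<integral>x. A x \<partial>\<mu>) + ereal e" using le by simp
    also have "\<dots> \<le> ?sup + ereal e"
      using \<mu> by (intro add_right_mono SUP_upper) auto
    finally show "ereal (\<integral>x. A x \<partial>\<nu>) \<le> ?sup + ereal e" .
  qed
  show "?sup \<le> beta l \<Sigma> A \<phi> r"
    unfolding beta_def by (rule SUP_subset_mono) auto
qed

end
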